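(* Let $G=(V,E)$ be a non-oriented, countable, connected, locally finite graph. Let $(U_k)_{k\in\mathbb{N}}$ be a sequence of finite subsets of $V$ with $U_k\subset\mathring{U}_{k+1}$ for all $k$ and $\bigcup_{k\in\mathbb{N}}U_k=V$, and let $p(t,x,y)=\lim_{k\to\infty}p_k(t,x,y)$ for $t>0$, $x,y\in V$, where $p_k$ is the Dirichlet heat kernel of $U_k$ extended by zero. Then $p$ is a function $(0,\infty)\times V\times V\to\mathbb{R}_{\ge 0}$ (in particular finite-valued), it is a fundamental solution of the heat equation $\frac{\partial}{\partial t}u+\Delta u=0$ on $G$, and it does not depend on the choice of the exhaustion sequence $(U_k)_{k\in\mathbb{N}}$.
   Context: For $x,y\in V$, $x\sim y$ means that $x$ and $y$ are joined by an edge; the (physical) Laplacian acts on any function $f$ on $V$ by $\Delta f(x)=\sum_{y\sim x}(f(x)-f(y))$ (and on functions of $(t,x)$ it acts in the variable $x$). Fundamental solution: a function $p:(0,\infty)\times V\times V\to\mathbb{R}$ is a fundamental solution of the heat equation if for every bounded $u_0:V\to\mathbb{R}$ the function $u(t,x)=\sum_{y\in V}p(t,x,y)u_0(y)$, $t>0$, $x\in V$, is differentiable in $t$, satisfies $\frac{\partial}{\partial t}u+\Delta u=0$, and $\lim_{t\to0^+}u(t,x)=u_0(x)$ for every $x\in V$. For $U\subset V$ the interior is $\mathring{U}=\{x\in U: y\sim x\Rightarrow y\in U\}$. For finite $U$, the Dirichlet Laplacian is $\Delta_U=\pi\circ\Delta\circ\iota:\ell^2(\mathring{U})\to\ell^2(\mathring{U})$,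 where $\iota$ is extension by zero to $V$ and $\pi$ is restriction to $\mathring{U}$. Its heat kernel is $p_U(t,x,y)=(\mathrm{e}^{-t\Delta_U}\delta_y)(x)$ for $t>0$, $x,y\in\mathring{U}$, where $\delta_y$ is the indicator function of $\{y\}$. One writes $p_k=p_{U_k}$, extended to $(0,\infty)\times V\times V$ by setting $p_k(t,x,y)=0$ if $x\notin\mathring{U}_k$ or $y\notin\mathring{U}_k$. One has $p_k\le p_{k+1}$, so the limit defining $p$ exists in $[0,\infty]$. *)

theory Defs
  imports "HOL-Analysis.Analysis"
begin

text \<open>A non-oriented graph is a vertex set \<open>V\<close> with a set \<open>E\<close> of unordered pairs of vertices.
  Loops (singleton edges) are not excluded; they contribute nothing to the Laplacian and do not
  affect interiors.\<close>

definition adj :: "'a set set \<Rightarrow> 'a \<Rightarrow> 'a \<Rightarrow> bool" where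
  "adj E x y \<longleftrightarrow> {x, y} \<in> E"

locale locally_finite_graph =
  fixes V :: "'a set" and E :: "'a set set"
  assumes edges: "E \<subseteq> {{x, y} | x y. x \<in> V \<and> y \<in> V}"
    and countable_verts: "countable V"
    and connected: "\<And>x y. x \<in> V \<Longrightarrow> y \<in> V \<Longrightarrow> (adj E)\<^sup>*\<^sup>* x y"
    and locally_finite: "\<And>x. x \<in> V \<Longrightarrow> finite {y. adj E y x}"

text \<open>Functions on \<open>V\<close> are represented by functions on the whole vertex type, of which only the
  values on \<open>V\<close> matter. Neighbours of a vertex lie in \<open>V\<close> automatically.\<close>

definition laplacian :: "'a set set \<Rightarrow> ('a \<Rightarrow> real) \<Rightarrow> 'a \<Rightarrow> real" where
  "laplacian E f x = (\<Sum>y | adj E y x. f x - f y)"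

definition graph_interior :: "'a set set \<Rightarrow> 'a set \<Rightarrow> 'a set" where
  "graph_interior E U = {x \<in> U. \<forall>y. adj E y x \<longrightarrow> y \<in> U}"

definition zero_ext :: "'a set \<Rightarrow> ('a \<Rightarrow> real) \<Rightarrow> 'a \<Rightarrow> real" where
  "zero_ext W f = (\<lambda>x. if x \<in> W then f x else 0)"

text \<open>The operator \<open>\<pi> \<circ> \<Delta> \<circ> \<iota>\<close>. For finite \<open>U\<close>, the space of square-summable functions on the
  interior \<open>W\<close> of \<open>U\<close> consists of all functions on \<open>W\<close>; \<open>restrict\<close> makes the values outside \<open>W\<close>
  unspecified, and \<open>zero_ext\<close> ignores them.\<close>

definition dirichlet_laplacian :: "'a set set \<Rightarrow> 'a set \<Rightarrow> ('a \<Rightarrow> real) \<Rightarrow> 'a \<Rightarrow> real" where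
  "dirichlet_laplacian E U f =
     (let W = graph_interior E U in restrict (laplacian E (zero_ext W f)) W)"

text \<open>The exponential series of an operator. It is only used for an operator on a
  finite-dimensional function space, where pointwise convergence and convergence in operator norm
  coincide.\<close>

definition op_exp :: "(('a \<Rightarrow> real) \<Rightarrow> 'a \<Rightarrow> real) \<Rightarrow> ('a \<Rightarrow> real) \<Rightarrow> 'a \<Rightarrow> real" where
  "op_exp A f x = (\<Sum>n. (A ^^ n) f x / fact n)"

text \<open>The Dirichlet heat kernel of \<open>U\<close>, extended by zero.\<close>

definition dirichlet_heat_kernel :: "'a set set \<Rightarrow> 'a set \<Rightarrow> real \<Rightarrow> 'a \<Rightarrow> 'a \<Rightarrow> real" where
  "dirichlet_heat_kernel E U t x y =
     (if x \<in> graph_interior E U \<and> y \<in> graph_interior E U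
      then op_exp (\<lambda>f z. - t * dirichlet_laplacian E U f z) (indicator {y}) x
      else 0)"

definition exhaustion :: "'a set \<Rightarrow> 'a set set \<Rightarrow> (nat \<Rightarrow> 'a set) \<Rightarrow> bool" where
  "exhaustion V E U \<longleftrightarrow>
     (\<forall>k. finite (U k) \<and> U k \<subseteq> V \<and> U k \<subseteq> graph_interior E (U (Suc k))) \<and> (\<Union>k. U k) = V"

text \<open>The limit is taken in the extended reals, so that finiteness is a claim about it.\<close>

definition exhaustion_heat_kernel ::
    "'a set set \<Rightarrow> (nat \<Rightarrow> 'a set) \<Rightarrow> real \<Rightarrow> 'a \<Rightarrow> 'a \<Rightarrow> ereal" where
  "exhaustion_heat_kernel E U t x y = lim (\<lambda>k. ereal (dirichlet_heat_kernel E (U k) t x y))"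

text \<open>Summability is required explicitly because \<open>infsum\<close> is \<open>0\<close> for non-summable families.\<close>

definition fundamental_solution ::
    "'a set \<Rightarrow> 'a set set \<Rightarrow> (real \<Rightarrow> 'a \<Rightarrow> 'a \<Rightarrow> real) \<Rightarrow> bool" where
  "fundamental_solution V E p \<longleftrightarrow>
     (\<forall>u0 :: 'a \<Rightarrow> real. bounded (u0 ` V) \<longrightarrow>
       (let u = (\<lambda>t x. \<Sum>\<^sub>\<infinity>y\<in>V. p t x y * u0 y) in
         (\<forall>t>0. \<forall>x\<in>V. (\<lambda>y. p t x y * u0 y) summable_on V) \<and>
         (\<forall>t>0. \<forall>x\<in>V. (\<lambda>s. u s x) differentiable (at t)) \<and>
         (\<forall>t>0. \<forall>x\<in>V. deriv (\<lambda>s. u s x) t + laplacian E (u t) x = 0) \<and>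
         (\<forall>x\<in>V. ((\<lambda>t. u t x) \<longlongrightarrow> u0 x) (at_right 0))))"

end

theory Submission
  imports Defs
begin

text \<open>
  Let \<open>\<Delta>\<^sub>W\<close> be the Laplacian with Dirichlet condition outside a finite set \<open>W\<close>, and let \<open>c\<close> be at
  least the largest degree in \<open>W\<close>. The operator \<open>c - \<Delta>\<^sub>W\<close> has nonnegative matrix entries
  (\<open>c - deg x\<close> on the diagonal, the adjacency matrix elsewhere), it grows entrywise with \<open>W\<close>, and
  its row sums are at most \<open>c\<close>. Since \<open>exp (-t\<Delta>\<^sub>W) = exp (-ct) exp (t(c - \<Delta>\<^sub>W))\<close>
  (\<open>heat_flow_eq_shifted\<close>), these three facts pass through the exponential series: the Dirichlet
  kernels are nonnegative, increase with the domain (\<open>dirichlet_heat_kernel_mono\<close>), and have row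
  sums at most \<open>1\<close> (\<open>sum_dirichlet_heat_kernel_le_1\<close>). This replaces the maximum principle. The
  limit kernel therefore exists, is finite, and is summable with sum at most \<open>1\<close> in the second
  vertex. Each member of one exhaustion is finite, hence contained in some member of any other,
  so monotonicity also makes the limit independent of the exhaustion.

  For bounded data \<open>u0\<close> with \<open>\<bar>u0\<bar> \<le> C\<close>, let \<open>u\<^sub>k\<close> be the Dirichlet solution on the \<open>k\<close>-th set.
  Dominated convergence gives \<open>u\<^sub>k \<longlonglongrightarrow> u\<close> pointwise. To carry the equation to the limit without
  any convergence of derivatives, one uses estimates that are uniform in \<open>k\<close>: as \<open>\<bar>u\<^sub>k\<bar> \<le> C\<close>
  and \<open>u\<^sub>k\<close> solves the heat equation, it is Lipschitz in time with constant \<open>2 deg(x) C\<close>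
  (\<open>abs_heat_flow_diff_le\<close>), and then \<open>\<Delta>u\<^sub>k\<close> is Lipschitz in time as well, so that
  \<open>\<bar>u\<^sub>k(s,x) - u\<^sub>k(t,x) + (s - t) \<Delta>u\<^sub>k(t,x)\<bar> \<le> K (s - t)\<^sup>2\<close> with \<open>K\<close> depending only on the degrees
  around \<open>x\<close> and on \<open>C\<close> (\<open>heat_flow_taylor\<close>). Both inequalities contain finitely many values
  of \<open>u\<^sub>k\<close>, so they hold for \<open>u\<close>. The second one is differentiability of \<open>u\<close> together with the
  heat equation, and the first one, taken between \<open>0\<close> and \<open>t\<close>, is the initial condition.
\<close>

text \<open>The family is viewed as integrands for the counting measure, where Lebesgue's theorem applies.\<close>

lemma infsum_dominated_convergence:
  fixes f :: "nat \<Rightarrow> 'b \<Rightarrow> real"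
  assumes "g summable_on A"
    and "\<And>k y. y \<in> A \<Longrightarrow> \<bar>f k y\<bar> \<le> g y"
    and "\<And>y. y \<in> A \<Longrightarrow> (\<lambda>k. f k y) \<longlonglongrightarrow> h y"
  shows "(\<lambda>k. \<Sum>\<^sub>\<infinity>y\<in>A. f k y) \<longlonglongrightarrow> (\<Sum>\<^sub>\<infinity>y\<in>A. h y)"
proof -
  have bound_h: "\<bar>h y\<bar> \<le> g y" if "y \<in> A" for y
    by (rule LIMSEQ_le_const2[OF tendsto_rabs[OF assms(3)[OF that]]]) (use assms(2) that in auto)
  have abs: "Infinite_Sum.abs_summable_on r A" if "\<And>y. y \<in> A \<Longrightarrow> \<bar>r y\<bar> \<le> g y" for r :: "'b \<Rightarrow> real"
    by (rule Infinite_Sum.abs_summable_on_comparison_test'[OF assms(1)]) (use that in auto)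
  have int: "integrable (count_space A) r" "(\<Sum>\<^sub>\<infinity>y\<in>A. r y) = integral\<^sup>L (count_space A) r"
    if "\<And>y. y \<in> A \<Longrightarrow> \<bar>r y\<bar> \<le> g y" for r :: "'b \<Rightarrow> real"
    using abs[OF that] infsetsum_infsum[of r A] abs_summable_equivalent[of r A]
    by (simp_all add: Infinite_Set_Sum.abs_summable_on_def infsetsum_def)
  have g_nonneg: "0 \<le> g y" if "y \<in> A" for y
    using bound_h[OF that] by simp
  have "(\<lambda>k. integral\<^sup>L (count_space A) (f k)) \<longlonglongrightarrow> integral\<^sup>L (count_space A) h"
    by (rule integral_dominated_convergence[where w = g])
      (use assms(2,3) g_nonneg in \<open>auto simp: AE_count_space intro!: int(1)\<close>)
  then show ?thesis
    by (simp add: int(2)[OF assms(2)] int(2)[OF bound_h])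
qed

section \<open>The shifted generator of the heat flow killed outside a set\<close>

text \<open>This is \<open>c - \<Delta>\<^sub>W\<close>, made into an operator on all functions by vanishing outside \<open>W\<close>, so that
  its iterates for different \<open>W\<close> can be compared. With \<open>c = 0\<close> it generates the heat flow.\<close>

definition shifted_generator ::
    "'a set set \<Rightarrow> real \<Rightarrow> 'a set \<Rightarrow> ('a \<Rightarrow> real) \<Rightarrow> 'a \<Rightarrow> real" where
  "shifted_generator E c W f = zero_ext W (\<lambda>x. c * f x - laplacian E (zero_ext W f) x)"

definition vertex_degree :: "'a set set \<Rightarrow> 'a \<Rightarrow> real" where
  "vertex_degree E x = real (card {y. adj E y x})"

text \<open>The function \<open>exp (-t\<Delta>\<^sub>W) f\<close>, written as a power series in \<open>t\<close>.\<close>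

definition heat_flow ::
    "'a set set \<Rightarrow> 'a set \<Rightarrow> real \<Rightarrow> ('a \<Rightarrow> real) \<Rightarrow> 'a \<Rightarrow> real" where
  "heat_flow E W t f x = (\<Sum>n. (shifted_generator E 0 W ^^ n) f x / fact n * t ^ n)"

lemma zero_ext_zero_ext [simp]: "zero_ext W (zero_ext W f) = zero_ext W f"
  by (auto simp: zero_ext_def)

lemma zero_ext_cong: "(\<And>x. x \<in> W \<Longrightarrow> f x = g x) \<Longrightarrow> zero_ext W f = zero_ext W g"
  by (auto simp: zero_ext_def)

text \<open>In this form all coefficients are visibly nonnegative once \<open>c\<close> dominates the degrees in \<open>W\<close>.\<close>

lemma shifted_generator_eq_degree:
  assumes "x \<in> W"
  shows "shifted_generator E c W f x =
    (c - vertex_degree E x) * f x + (\<Sum>y | adj E y x. zero_ext W f y)"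
  using assms
  by (simp add: shifted_generator_def zero_ext_def laplacian_def vertex_degree_def
      sum_subtractf algebra_simps)

lemma shifted_generator_lincomb:
  "shifted_generator E c W (\<lambda>z. a * f z + b * g z) =
    (\<lambda>x. a * shifted_generator E c W f x + b * shifted_generator E c W g x)"
  by (rule ext) (auto simp: shifted_generator_def zero_ext_def laplacian_def sum_distrib_left
      sum.distrib[symmetric] sum_subtractf[symmetric] algebra_simps if_distrib cong: if_cong
      intro!: sum.cong)

lemma shifted_generator_pow_lincomb:
  "(shifted_generator E c W ^^ n) (\<lambda>z. a * f z + b * g z) =
    (\<lambda>x. a * (shifted_generator E c W ^^ n) f x + b * (shifted_generator E c W ^^ n) g x)"
  by (induction n) (simp_all add: shifted_generator_lincomb)

lemma shifted_generator_pow_sum: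
  assumes "finite F"
  shows "(shifted_generator E c W ^^ n) (\<lambda>z. \<Sum>y\<in>F. a y * f y z) x =
    (\<Sum>y\<in>F. a y * (shifted_generator E c W ^^ n) (f y) x)"
  using assms
proof (induction F arbitrary: x)
  case empty
  show ?case using shifted_generator_pow_lincomb[of n E c W 0 "\<lambda>_. 0" 0 "\<lambda>_. 0"] by simp
next
  case (insert y F)
  then show ?case
    using shifted_generator_pow_lincomb[of n E c W "a y" "f y" 1 "\<lambda>z. \<Sum>y\<in>F. a y * f y z"]
    by simp
qed

lemma zero_ext_shifted_generator_pow:
  assumes "zero_ext W f = f"
  shows "zero_ext W ((shifted_generator E c W ^^ n) f) = (shifted_generator E c W ^^ n) f"
  using assms by (cases n) (simp_all add: shifted_generator_def)

lemma shifted_generator_0_eq: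
  assumes "zero_ext W f = f"
  shows "shifted_generator E 0 W f = (\<lambda>x. 1 * shifted_generator E c W f x + (- c) * f x)"
proof
  fix x
  have "f x = 0" if "x \<notin> W" using fun_cong[OF assms, of x] that by (simp add: zero_ext_def)
  then show "shifted_generator E 0 W f x = 1 * shifted_generator E c W f x + (- c) * f x"
    by (simp add: shifted_generator_def zero_ext_def)
qed

text \<open>The binomial theorem for commuting operators \<open>A = B + b\<close>, applied to \<open>a n j = A\<^sup>n B\<^sup>j f x\<close>: only
  the recursion between these numbers matters.\<close>

lemma binomial_transform:
  fixes a :: "nat \<Rightarrow> nat \<Rightarrow> real"
  assumes "\<And>n j. a (Suc n) j = a n (Suc j) + b * a n j"
  shows "a n j = (\<Sum>i\<le>n. real (n choose i) * b ^ i * a 0 (j + (n - i)))"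
proof (induction n arbitrary: j)
  case 0
  show ?case by simp
next
  case (Suc n)
  have 1: "(\<Sum>i\<le>n. real (n choose i) * b ^ i * a 0 (Suc j + (n - i))) =
      a 0 (Suc (j + n)) + (\<Sum>i\<le>n. real (n choose Suc i) * b ^ Suc i * a 0 (j + (n - i)))"
  proof -
    have "(\<Sum>i\<le>n. real (n choose i) * b ^ i * a 0 (Suc j + (n - i))) =
        (\<Sum>i\<le>Suc n. real (n choose i) * b ^ i * a 0 (j + (Suc n - i)))"
      by (simp add: Suc_diff_le)
    then show ?thesis
      by (simp add: sum.atMost_Suc_shift del: sum.atMost_Suc)
  qed
  have "a (Suc n) j = a n (Suc j) + b * a n j"
    by (rule assms)
  also have "\<dots> = (\<Sum>i\<le>n. real (n choose i) * b ^ i * a 0 (Suc j + (n - i)))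
      + (\<Sum>i\<le>n. real (n choose i) * b ^ Suc i * a 0 (j + (n - i)))"
    by (subst (1 2) Suc.IH) (simp add: sum_distrib_left mult_ac)
  also have "\<dots> = a 0 (Suc (j + n)) +
      (\<Sum>i\<le>n. real (Suc n choose Suc i) * b ^ Suc i * a 0 (j + (n - i)))"
    by (simp only: 1) (simp add: sum.distrib algebra_simps)
  also have "\<dots> = (\<Sum>i\<le>Suc n. real (Suc n choose i) * b ^ i * a 0 (j + (Suc n - i)))"
    by (simp add: sum.atMost_Suc_shift del: sum.atMost_Suc)
  finally show ?case .
qed

lemma shifted_generator_pow_binomial:
  assumes "zero_ext W f = f"
  shows "(shifted_generator E 0 W ^^ n) f x =
    (\<Sum>i\<le>n. real (n choose i) * (- c) ^ i * (shifted_generator E c W ^^ (n - i)) f x)"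
proof -
  let ?a = "\<lambda>n j. (shifted_generator E 0 W ^^ n) ((shifted_generator E c W ^^ j) f) x"
  have "?a (Suc n) j = ?a n (Suc j) + (- c) * ?a n j" for n j
  proof -
    have "?a (Suc n) j =
        (shifted_generator E 0 W ^^ n)
          (shifted_generator E 0 W ((shifted_generator E c W ^^ j) f)) x"
      by (simp add: funpow_swap1)
    also have "\<dots> = ?a n (Suc j) + (- c) * ?a n j"
      unfolding shifted_generator_0_eq[OF zero_ext_shifted_generator_pow[OF assms], where c = c]
        shifted_generator_pow_lincomb by simp
    finally show ?thesis .
  qed
  from binomial_transform[of ?a "- c", OF this, of n 0] show ?thesis by simp
qed

section \<open>Bounds for the shifted generator\<close>

text \<open>The absolute values of the coefficients in a row of \<open>c - \<Delta>\<^sub>W\<close> add up to at most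
  \<open>(c - deg x) + deg x = c\<close>, so the operator has supremum norm at most \<open>c\<close>.\<close>

lemma abs_shifted_generator_pow_le:
  assumes deg: "\<And>x. x \<in> W \<Longrightarrow> vertex_degree E x \<le> c" and "0 \<le> c"
    and f: "\<And>x. \<bar>f x\<bar> \<le> C"
  shows "\<bar>(shifted_generator E c W ^^ n) f x\<bar> \<le> c ^ n * C"
proof (induction n arbitrary: x)
  case 0
  show ?case using f by simp
next
  case (Suc n)
  let ?g = "(shifted_generator E c W ^^ n) f"
  have C: "0 \<le> c ^ n * C" using Suc.IH[of x] by simp
  show ?case
  proof (cases "x \<in> W")
    case True
    have "\<bar>shifted_generator E c W ?g x\<bar> \<le>
        \<bar>(c - vertex_degree E x) * ?g x\<bar> + \<bar>\<Sum>y | adj E y x. zero_ext W ?g y\<bar>"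
      using True by (simp add: shifted_generator_eq_degree)
    also have "\<dots> \<le> (c - vertex_degree E x) * (c ^ n * C) + (\<Sum>y | adj E y x. c ^ n * C)"
    proof (intro add_mono)
      show "\<bar>(c - vertex_degree E x) * ?g x\<bar> \<le> (c - vertex_degree E x) * (c ^ n * C)"
        using deg[OF True] Suc.IH[of x] by (simp add: abs_mult mult_left_mono)
      show "\<bar>\<Sum>y | adj E y x. zero_ext W ?g y\<bar> \<le> (\<Sum>y | adj E y x. c ^ n * C)"
        by (rule order.trans[OF sum_abs sum_mono]) (use Suc.IH C in \<open>auto simp: zero_ext_def\<close>)
    qed
    also have "\<dots> = c ^ Suc n * C"
      by (simp add: vertex_degree_def algebra_simps)
    finally show ?thesis by simp
  next
    case False
    then show ?thesis
      using C \<open>0 \<le> c\<close> by (simp add: shifted_generator_def zero_ext_def mult.assoc)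
  qed
qed

text \<open>Passing from \<open>W\<close> to \<open>W'\<close> only adds nonnegative matrix entries. The induction carries
  positivity along because the added entries contribute nonnegatively only on nonnegative functions.\<close>

lemma shifted_generator_pow_mono:
  assumes deg: "\<And>x. x \<in> W' \<Longrightarrow> vertex_degree E x \<le> c" and "W \<subseteq> W'"
    and f: "\<And>x. 0 \<le> f x" and fg: "\<And>x. f x \<le> g x"
  shows "0 \<le> (shifted_generator E c W ^^ n) f x \<and>
    (shifted_generator E c W ^^ n) f x \<le> (shifted_generator E c W' ^^ n) g x"
proof (induction n arbitrary: x)
  case 0
  show ?case using f fg by simp
next
  case (Suc n)
  let ?f = "(shifted_generator E c W ^^ n) f" and ?g = "(shifted_generator E c W' ^^ n) g"
  have le: "0 \<le> ?f y" "?f y \<le> ?g y" "0 \<le> ?g y" for y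
    using Suc.IH[of y] by auto
  have g_nonneg: "0 \<le> shifted_generator E c W' ?g x"
  proof (cases "x \<in> W'")
    case True
    then show ?thesis
      using deg[OF True] le
      by (auto simp: shifted_generator_eq_degree zero_ext_def intro!: add_nonneg_nonneg sum_nonneg)
  next
    case False
    then show ?thesis by (simp add: shifted_generator_def zero_ext_def)
  qed
  show ?case
  proof (cases "x \<in> W")
    case True
    then have W': "x \<in> W'" using \<open>W \<subseteq> W'\<close> by auto
    have "(c - vertex_degree E x) * ?f x \<le> (c - vertex_degree E x) * ?g x"
      using deg[OF W'] le by (intro mult_left_mono) auto
    moreover have "(\<Sum>y | adj E y x. zero_ext W ?f y) \<le> (\<Sum>y | adj E y x. zero_ext W' ?g y)"
      using le \<open>W \<subseteq> W'\<close> by (intro sum_mono) (auto simp: zero_ext_def)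
    moreover have "0 \<le> (c - vertex_degree E x) * ?f x + (\<Sum>y | adj E y x. zero_ext W ?f y)"
      using deg[OF W'] le by (auto simp: zero_ext_def intro!: add_nonneg_nonneg sum_nonneg)
    ultimately show ?thesis
      using True W' by (simp add: shifted_generator_eq_degree)
  next
    case False
    then have "shifted_generator E c W ?f x = 0"
      by (simp add: shifted_generator_def zero_ext_def)
    then show ?thesis using g_nonneg by simp
  qed
qed

section \<open>The heat flow on functions supported in a set of bounded degree\<close>

lemma summable_exp_powers:
  fixes a :: "nat \<Rightarrow> real"
  assumes "\<And>n. \<bar>a n\<bar> \<le> c ^ n * C" and "0 \<le> c"
  shows "summable (\<lambda>n. norm (a n / fact n * t ^ n))"
proof (rule summable_comparison_test)
  show "summable (\<lambda>n. C * (inverse (fact n) * (c * \<bar>t\<bar>) ^ n))"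
    by (intro summable_mult summable_exp)
  have "\<bar>a n\<bar> * \<bar>t ^ n\<bar> / fact n \<le> c ^ n * C * \<bar>t ^ n\<bar> / fact n" for n
    using assms by (intro divide_right_mono mult_right_mono) auto
  then show "\<exists>N. \<forall>n\<ge>N. norm (norm (a n / fact n * t ^ n)) \<le>
      C * (inverse (fact n) * (c * \<bar>t\<bar>) ^ n)"
    by (auto simp: abs_mult power_mult_distrib power_abs field_simps)
qed

lemma heat_flow_outside:
  assumes supp: "zero_ext W f = f" and "x \<notin> W"
  shows "heat_flow E W t f x = 0"
proof -
  have "(shifted_generator E 0 W ^^ n) f x = 0" for n
    using fun_cong[OF zero_ext_shifted_generator_pow[OF supp, where E = E and c = 0 and n = n], of x] assms
    by (simp add: zero_ext_def)
  then show ?thesis by (simp add: heat_flow_def)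
qed

lemma heat_flow_0: "heat_flow E W 0 f x = f x"
  using powser_zero[of "\<lambda>n. (shifted_generator E 0 W ^^ n) f x / fact n"]
  by (simp add: heat_flow_def)

context
  fixes E :: "'a set set" and W :: "'a set" and c C :: real and f :: "'a \<Rightarrow> real"
  assumes deg: "\<And>x. x \<in> W \<Longrightarrow> vertex_degree E x \<le> c" and c: "0 \<le> c"
    and supp: "zero_ext W f = f" and bound: "\<And>x. \<bar>f x\<bar> \<le> C"
begin

lemma summable_shifted_flow:
  "summable (\<lambda>n. norm ((shifted_generator E c W ^^ n) f x / fact n * t ^ n))"
  by (rule summable_exp_powers[where c = c and C = C])
    (use abs_shifted_generator_pow_le[OF deg c bound] c in auto)

text \<open>The Cauchy product of the series of \<open>exp (-ct)\<close> and of \<open>exp (t(c - \<Delta>\<^sub>W)) f\<close> has the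
  coefficients of \<open>exp (-t\<Delta>\<^sub>W) f\<close> by the binomial theorem.\<close>

lemma heat_flow_sums_shifted:
  "(\<lambda>n. (shifted_generator E 0 W ^^ n) f x / fact n * t ^ n) sums
    (exp (- c * t) * (\<Sum>n. (shifted_generator E c W ^^ n) f x / fact n * t ^ n))"
proof -
  have "summable (\<lambda>n. norm ((- c * t) ^ n / fact n))"
    using summable_norm_exp[of "- c * t"] by (simp add: field_simps)
  from Cauchy_product_sums[OF this summable_shifted_flow]
  have "(\<lambda>k. \<Sum>i\<le>k. (- c * t) ^ i / fact i *
        ((shifted_generator E c W ^^ (k - i)) f x / fact (k - i) * t ^ (k - i))) sums
      ((\<Sum>k. (- c * t) ^ k / fact k) *
        (\<Sum>n. (shifted_generator E c W ^^ n) f x / fact n * t ^ n))" .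
  moreover have "(\<Sum>k. (- c * t) ^ k / fact k) = exp (- c * t)"
    by (simp add: exp_def field_simps)
  moreover have "(\<Sum>i\<le>k. (- c * t) ^ i / fact i *
        ((shifted_generator E c W ^^ (k - i)) f x / fact (k - i) * t ^ (k - i))) =
      (shifted_generator E 0 W ^^ k) f x / fact k * t ^ k" for k
    unfolding shifted_generator_pow_binomial[OF supp, where c = c] sum_divide_distrib
      sum_distrib_right
  proof (rule sum.cong[OF refl])
    fix i assume "i \<in> {..k}"
    then have i: "i \<le> k" by simp
    have t: "t ^ k = t ^ i * t ^ (k - i)"
      using i by (simp flip: power_add)
    show "(- c * t) ^ i / fact i *
          ((shifted_generator E c W ^^ (k - i)) f x / fact (k - i) * t ^ (k - i)) =
        real (k choose i) * (- c) ^ i * (shifted_generator E c W ^^ (k - i)) f x / fact k * t ^ k"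
      unfolding binomial_fact[OF i] t power_mult_distrib by (simp add: field_simps)
  qed
  ultimately show ?thesis by simp
qed

lemma summable_heat_flow:
  "summable (\<lambda>n. (shifted_generator E 0 W ^^ n) f x / fact n * t ^ n)"
  using heat_flow_sums_shifted by (rule sums_summable)

lemma heat_flow_eq_shifted:
  "heat_flow E W t f x =
    exp (- c * t) * (\<Sum>n. (shifted_generator E c W ^^ n) f x / fact n * t ^ n)"
  unfolding heat_flow_def using heat_flow_sums_shifted by (rule sums_unique[symmetric])

text \<open>The bound \<open>exp (ct) C\<close> for the shifted series is cancelled exactly by the factor \<open>exp (-ct)\<close>.
  This contraction property takes the place of the maximum principle.\<close>

lemma abs_heat_flow_le:
  assumes "0 \<le> t"
  shows "\<bar>heat_flow E W t f x\<bar> \<le> C"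
proof -
  let ?a = "\<lambda>n. (shifted_generator E c W ^^ n) f x / fact n * t ^ n"
  have exp_sums: "(\<lambda>n. (c * t) ^ n / fact n * C) sums (exp (c * t) * C)"
    using sums_mult2[OF exp_converges[of "c * t"], of C] by (simp add: field_simps)
  have "\<bar>\<Sum>n. ?a n\<bar> \<le> (\<Sum>n. norm (?a n))"
    using summable_norm[OF summable_shifted_flow] by simp
  also have "\<dots> \<le> (\<Sum>n. (c * t) ^ n / fact n * C)"
  proof (rule suminf_le[OF _ summable_shifted_flow sums_summable[OF exp_sums]])
    fix n
    have "\<bar>(shifted_generator E c W ^^ n) f x\<bar> * t ^ n / fact n \<le> c ^ n * C * t ^ n / fact n"
      using assms abs_shifted_generator_pow_le[OF deg c bound]
      by (intro divide_right_mono mult_right_mono) auto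
    then show "norm (?a n) \<le> (c * t) ^ n / fact n * C"
      using assms by (simp add: abs_mult power_mult_distrib mult_ac)
  qed
  also have "\<dots> = exp (c * t) * C"
    using exp_sums by (rule sums_unique[symmetric])
  finally have "exp (- c * t) * \<bar>\<Sum>n. ?a n\<bar> \<le> exp (- c * t) * (exp (c * t) * C)"
    by (intro mult_left_mono) auto
  also have "\<dots> = C"
    by (simp add: mult.assoc[symmetric] exp_add[symmetric])
  finally show ?thesis
    by (simp add: heat_flow_eq_shifted abs_mult)
qed

lemma heat_flow_equation:
  assumes "x \<in> W"
  shows "((\<lambda>t. heat_flow E W t f x) has_real_derivative
    - laplacian E (heat_flow E W t f) x) (at t)"
proof -
  let ?a = "\<lambda>n x. (shifted_generator E 0 W ^^ n) f x"
  have sums: "(\<lambda>n. ?a n y / fact n * t ^ n) sums heat_flow E W t f y" for y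
    unfolding heat_flow_def using summable_heat_flow by (rule summable_sums)
  have "(\<lambda>n. - (\<Sum>y | adj E y x. ?a n x / fact n * t ^ n - ?a n y / fact n * t ^ n)) sums
      (- (\<Sum>y | adj E y x. heat_flow E W t f x - heat_flow E W t f y))"
    by (intro sums_minus sums_sum sums_diff sums)
  also have "(\<lambda>n. - (\<Sum>y | adj E y x. ?a n x / fact n * t ^ n - ?a n y / fact n * t ^ n)) =
      (\<lambda>n. diffs (\<lambda>n. ?a n x / fact n) n * t ^ n)"
  proof
    fix n
    have "?a (Suc n) x = - laplacian E (?a n) x"
      using assms zero_ext_shifted_generator_pow[OF supp, where E = E and c = 0 and n = n]
      by (simp add: shifted_generator_def zero_ext_def)
    moreover have "diffs (\<lambda>n. ?a n x / fact n) n = ?a (Suc n) x / fact n"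
      by (simp add: diffs_def field_simps del: funpow.simps of_nat_Suc)
    ultimately show "- (\<Sum>y | adj E y x. ?a n x / fact n * t ^ n - ?a n y / fact n * t ^ n) =
        diffs (\<lambda>n. ?a n x / fact n) n * t ^ n"
      by (simp add: laplacian_def sum_divide_distrib sum_distrib_right diff_divide_distrib
          left_diff_distrib del: funpow.simps)
  qed
  finally have "(\<Sum>n. diffs (\<lambda>n. ?a n x / fact n) n * t ^ n) = - laplacian E (heat_flow E W t f) x"
    unfolding laplacian_def by (rule sums_unique[symmetric])
  with termdiffs_strong_converges_everywhere[of "\<lambda>n. ?a n x / fact n" t]
  show ?thesis unfolding heat_flow_def using summable_heat_flow by simp
qed

text \<open>By the heat equation and the contraction property, the time derivative at \<open>x\<close> is a sum of
  \<open>deg x\<close> differences of values in \<open>[-C, C]\<close>.\<close>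

lemma abs_heat_flow_diff_le:
  assumes "0 \<le> s" and "0 \<le> t"
  shows "\<bar>heat_flow E W s f x - heat_flow E W t f x\<bar> \<le> 2 * vertex_degree E x * C * \<bar>s - t\<bar>"
proof (cases "x \<in> W")
  case True
  have "\<bar>laplacian E (heat_flow E W r f) x\<bar> \<le> 2 * vertex_degree E x * C" if "0 \<le> r" for r
  proof -
    have "\<bar>laplacian E (heat_flow E W r f) x\<bar> \<le> (\<Sum>y | adj E y x. C + C)"
      unfolding laplacian_def
      by (rule order.trans[OF sum_abs sum_mono],
          rule order.trans[OF abs_triangle_ineq4 add_mono]) (use abs_heat_flow_le that in auto)
    then show ?thesis by (simp add: vertex_degree_def)
  qed
  then have "norm (heat_flow E W s f x - heat_flow E W t f x) \<le>
      2 * vertex_degree E x * C * norm (s - t)"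
    using assms
    by (intro field_differentiable_bound[where S = "{0..}"
          and f' = "\<lambda>r. - laplacian E (heat_flow E W r f) x"]
        has_field_derivative_at_within[OF heat_flow_equation[OF True]]) auto
  then show ?thesis by simp
next
  case False
  have "0 \<le> C" using bound[of x] by simp
  then show ?thesis
    using heat_flow_outside[OF supp False] by (simp add: vertex_degree_def)
qed

text \<open>The time derivative \<open>-\<Delta>u(t,x)\<close> is itself Lipschitz, because \<open>u\<close> is Lipschitz in time at \<open>x\<close>
  and at its neighbours; this also holds at neighbours outside \<open>W\<close>, where the flow is constantly
  zero. The constant involves neither \<open>W\<close> nor \<open>c\<close>, so the estimate survives the limit.\<close>

lemma heat_flow_taylor:
  assumes "x \<in> W" and "0 \<le> s" and "0 \<le> t"
  shows "\<bar>heat_flow E W s f x - heat_flow E W t f x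
      - (s - t) * (- laplacian E (heat_flow E W t f) x)\<bar>
    \<le> (\<Sum>y | adj E y x. 2 * (vertex_degree E x + vertex_degree E y) * C) * (s - t)\<^sup>2"
proof -
  let ?L = "\<lambda>r. laplacian E (heat_flow E W r f) x"
  let ?K = "\<Sum>y | adj E y x. 2 * (vertex_degree E x + vertex_degree E y) * C"
  have C: "0 \<le> C" using bound[of x] by simp
  have L: "\<bar>?L t - ?L r\<bar> \<le> ?K * \<bar>s - t\<bar>" if r: "r \<in> closed_segment t s" for r
  proof -
    have r0: "0 \<le> r" and rt: "\<bar>t - r\<bar> \<le> \<bar>s - t\<bar>"
      using r assms by (auto simp: closed_segment_eq_real_ivl split: if_splits)
    have "\<bar>?L t - ?L r\<bar> \<le> (\<Sum>y | adj E y x.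
        2 * vertex_degree E x * C * \<bar>t - r\<bar> + 2 * vertex_degree E y * C * \<bar>t - r\<bar>)"
      unfolding laplacian_def sum_subtractf[symmetric]
    proof (rule order.trans[OF sum_abs sum_mono])
      fix y
      show "\<bar>heat_flow E W t f x - heat_flow E W t f y - (heat_flow E W r f x - heat_flow E W r f y)\<bar>
          \<le> 2 * vertex_degree E x * C * \<bar>t - r\<bar> + 2 * vertex_degree E y * C * \<bar>t - r\<bar>"
        using abs_heat_flow_diff_le[OF \<open>0 \<le> t\<close> r0, of x] abs_heat_flow_diff_le[OF \<open>0 \<le> t\<close> r0, of y]
        by linarith
    qed
    also have "\<dots> = ?K * \<bar>t - r\<bar>"
      unfolding sum_distrib_right by (rule sum.cong[OF refl]) (simp add: algebra_simps)
    also have "\<dots> \<le> ?K * \<bar>s - t\<bar>"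
      using rt C by (intro mult_left_mono sum_nonneg) (auto simp: vertex_degree_def)
    finally show ?thesis .
  qed
  \<comment> \<open>The mean value inequality for the flow with its linear part at time \<open>t\<close> removed.\<close>
  have "norm ((heat_flow E W s f x + s * ?L t) - (heat_flow E W t f x + t * ?L t)) \<le>
      ?K * \<bar>s - t\<bar> * norm (s - t)"
  proof (rule field_differentiable_bound[where S = "closed_segment t s"
        and f' = "\<lambda>r. - ?L r + ?L t"])
    show "((\<lambda>r. heat_flow E W r f x + r * ?L t) has_real_derivative - ?L r + ?L t)
        (at r within closed_segment t s)" for r
      by (rule has_field_derivative_at_within)
        (auto intro!: derivative_eq_intros heat_flow_equation[OF \<open>x \<in> W\<close>])
    show "norm (- ?L r + ?L t) \<le> ?K * \<bar>s - t\<bar>" if "r \<in> closed_segment t s" for r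
      using L[OF that] by simp
  qed auto
  moreover have "?K * \<bar>s - t\<bar> * norm (s - t) = ?K * (s - t)\<^sup>2"
    by (simp only: real_norm_def mult.assoc abs_mult_self_eq power2_eq_square)
  moreover have "(heat_flow E W s f x + s * ?L t) - (heat_flow E W t f x + t * ?L t) =
      heat_flow E W s f x - heat_flow E W t f x - (s - t) * (- ?L t)"
    by (simp add: algebra_simps)
  ultimately show ?thesis by (simp only: real_norm_def)
qed

end

lemma heat_flow_mono:
  assumes deg: "\<And>x. x \<in> W' \<Longrightarrow> vertex_degree E x \<le> c" and c: "0 \<le> c"
    and W: "W \<subseteq> W'" and t: "0 \<le> t"
    and supp: "zero_ext W f = f" "zero_ext W' g = g"
    and f: "\<And>x. 0 \<le> f x" and fg: "\<And>x. f x \<le> g x" and g: "\<And>x. g x \<le> C"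
  shows "0 \<le> heat_flow E W t f x \<and> heat_flow E W t f x \<le> heat_flow E W' t g x"
proof -
  have deg_W: "vertex_degree E x \<le> c" if "x \<in> W" for x
    using deg W that by auto
  have bounds: "\<bar>f x\<bar> \<le> C" "\<bar>g x\<bar> \<le> C" for x
    using f[of x] fg[of x] g[of x] by auto
  note mono = shifted_generator_pow_mono[OF deg W f fg]
  note summable = summable_norm_cancel[OF summable_shifted_flow]
  note summables = summable[OF deg_W c supp(1) bounds(1)] summable[OF deg c supp(2) bounds(2)]
  have "0 \<le> (\<Sum>n. (shifted_generator E c W ^^ n) f x / fact n * t ^ n)"
    by (rule suminf_nonneg[OF summables(1)]) (use mono t in auto)
  moreover have "(\<Sum>n. (shifted_generator E c W ^^ n) f x / fact n * t ^ n) \<le>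
      (\<Sum>n. (shifted_generator E c W' ^^ n) g x / fact n * t ^ n)"
    by (rule suminf_le[OF _ summables])
      (use mono t in \<open>auto intro!: mult_right_mono divide_right_mono\<close>)
  ultimately show ?thesis
    by (simp add: heat_flow_eq_shifted[OF deg_W c supp(1) bounds(1)]
        heat_flow_eq_shifted[OF deg c supp(2) bounds(2)])
qed

lemma vertex_degree_bounded_on_finite:
  assumes "finite W"
  obtains c where "0 \<le> c" and "\<And>x. x \<in> W \<Longrightarrow> vertex_degree E x \<le> c"
proof
  show "0 \<le> (\<Sum>x\<in>W. vertex_degree E x)"
    by (simp add: sum_nonneg vertex_degree_def)
  show "vertex_degree E x \<le> (\<Sum>x\<in>W. vertex_degree E x)" if "x \<in> W" for x
    using assms that by (intro member_le_sum) (auto simp: vertex_degree_def)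
qed

section \<open>The Dirichlet heat kernel\<close>

lemma finite_graph_interior: "finite U \<Longrightarrow> finite (graph_interior E U)"
  by (rule finite_subset[of _ U]) (auto simp: graph_interior_def)

lemma graph_interior_mono: "U \<subseteq> U' \<Longrightarrow> graph_interior E U \<subseteq> graph_interior E U'"
  by (auto simp: graph_interior_def)

lemma zero_ext_indicator: "y \<in> W \<Longrightarrow> zero_ext W (indicator {y}) = indicator {y}"
  by (auto simp: zero_ext_def indicator_def)

text \<open>The restricted Laplacian is unspecified outside the interior, but each application starts by
  extending by zero, so the iterates agree at interior vertices.\<close>

lemma dirichlet_laplacian_pow:
  assumes "x \<in> graph_interior E U"
  shows "((\<lambda>f z. - t * dirichlet_laplacian E U f z) ^^ n) f x =
    t ^ n * (shifted_generator E 0 (graph_interior E U) ^^ n) f x"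
  using assms
proof (induction n arbitrary: x)
  case 0
  show ?case by simp
next
  case (Suc n)
  let ?W = "graph_interior E U"
  let ?A = "\<lambda>f z. - t * dirichlet_laplacian E U f z"
  let ?g = "(shifted_generator E 0 ?W ^^ n) f"
  have "zero_ext ?W ((?A ^^ n) f) = zero_ext ?W (\<lambda>z. t ^ n * ?g z)"
    using Suc.IH by (rule zero_ext_cong)
  moreover have "shifted_generator E 0 ?W (\<lambda>z. t ^ n * ?g z) x =
      t ^ n * shifted_generator E 0 ?W ?g x"
    using shifted_generator_lincomb[of E 0 ?W "t ^ n" ?g 0 ?g] by simp
  moreover have "shifted_generator E 0 ?W h x = - laplacian E (zero_ext ?W h) x" for h
    using Suc.prems by (simp add: shifted_generator_def zero_ext_def)
  ultimately show ?case
    using Suc.prems by (simp add: dirichlet_laplacian_def Let_def)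
qed

lemma dirichlet_heat_kernel_eq_heat_flow:
  "dirichlet_heat_kernel E U t x y =
    (if x \<in> graph_interior E U \<and> y \<in> graph_interior E U
     then heat_flow E (graph_interior E U) t (indicator {y}) x else 0)"
  unfolding dirichlet_heat_kernel_def op_exp_def heat_flow_def
  by (intro if_cong refl suminf_cong, subst dirichlet_laplacian_pow) (simp_all add: mult.commute)

lemma dirichlet_heat_kernel_mono:
  assumes "finite U'" and "U \<subseteq> U'" and "0 \<le> t"
  shows "0 \<le> dirichlet_heat_kernel E U t x y \<and>
    dirichlet_heat_kernel E U t x y \<le> dirichlet_heat_kernel E U' t x y"
proof -
  let ?W = "graph_interior E U" and ?W' = "graph_interior E U'"
  obtain c where c: "0 \<le> c" and deg: "\<And>x. x \<in> ?W' \<Longrightarrow> vertex_degree E x \<le> c"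
    using vertex_degree_bounded_on_finite[OF finite_graph_interior[OF assms(1)]] by metis
  have W: "?W \<subseteq> ?W'" using assms(2) by (rule graph_interior_mono)
  have "0 \<le> heat_flow E W1 t (indicator {y}) x \<and>
      heat_flow E W1 t (indicator {y}) x \<le> heat_flow E ?W' t (indicator {y}) x"
    if "y \<in> W1" "W1 \<subseteq> ?W'" for W1
    by (rule heat_flow_mono[OF deg c that(2) assms(3), where C = 1])
      (use that in \<open>auto simp: zero_ext_indicator indicator_def\<close>)
  then show ?thesis
    using W by (auto simp: dirichlet_heat_kernel_eq_heat_flow)
qed

text \<open>Decomposing the data into indicator functions of vertices turns the kernel sum into the heat
  flow, to which the estimates of the previous section apply.\<close>

lemma sum_dirichlet_heat_kernel:
  assumes "finite U"
  shows "(\<Sum>y\<in>graph_interior E U. dirichlet_heat_kernel E U t x y * u0 y) =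
    heat_flow E (graph_interior E U) t (zero_ext (graph_interior E U) u0) x"
proof (cases "x \<in> graph_interior E U")
  case True
  let ?W = "graph_interior E U"
  have fin: "finite ?W" using assms by (rule finite_graph_interior)
  obtain c where c: "0 \<le> c" and deg: "\<And>x. x \<in> ?W \<Longrightarrow> vertex_degree E x \<le> c"
    using vertex_degree_bounded_on_finite[OF fin] by metis
  have delta: "zero_ext ?W u0 = (\<lambda>z. \<Sum>y\<in>?W. u0 y * indicator {y} z)"
    using fin by (auto simp: zero_ext_def indicator_def of_bool_def if_distrib cong: if_cong)
  have "(\<lambda>n. \<Sum>y\<in>?W. u0 y * ((shifted_generator E 0 ?W ^^ n) (indicator {y}) x / fact n * t ^ n))
      sums (\<Sum>y\<in>?W. u0 y * heat_flow E ?W t (indicator {y}) x)"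
    unfolding heat_flow_def
    by (intro sums_sum sums_mult summable_sums summable_heat_flow[OF deg c, where C = 1])
      (auto simp: zero_ext_indicator indicator_def)
  also have "(\<lambda>n. \<Sum>y\<in>?W. u0 y * ((shifted_generator E 0 ?W ^^ n) (indicator {y}) x / fact n * t ^ n))
      = (\<lambda>n. (shifted_generator E 0 ?W ^^ n) (zero_ext ?W u0) x / fact n * t ^ n)"
    unfolding delta shifted_generator_pow_sum[OF fin]
    by (simp add: sum_divide_distrib sum_distrib_right mult.assoc)
  finally have "(\<Sum>y\<in>?W. u0 y * heat_flow E ?W t (indicator {y}) x) =
      heat_flow E ?W t (zero_ext ?W u0) x"
    unfolding heat_flow_def[of E ?W t "zero_ext ?W u0"] by (rule sums_unique)
  then show ?thesis
    using True by (simp add: dirichlet_heat_kernel_eq_heat_flow mult.commute)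
next
  case False
  then show ?thesis
    by (simp add: dirichlet_heat_kernel_eq_heat_flow heat_flow_outside)
qed

text \<open>The constant data \<open>1\<close> is not increased by the contraction property.\<close>

lemma sum_dirichlet_heat_kernel_le_1:
  assumes "finite U" and "finite F" and "0 \<le> t"
  shows "(\<Sum>y\<in>F. dirichlet_heat_kernel E U t x y) \<le> 1"
proof -
  let ?W = "graph_interior E U"
  have fin: "finite ?W" using assms(1) by (rule finite_graph_interior)
  obtain c where c: "0 \<le> c" and deg: "\<And>x. x \<in> ?W \<Longrightarrow> vertex_degree E x \<le> c"
    using vertex_degree_bounded_on_finite[OF fin] by metis
  have "(\<Sum>y\<in>F. dirichlet_heat_kernel E U t x y) \<le> (\<Sum>y\<in>F \<union> ?W. dirichlet_heat_kernel E U t x y)"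
    using dirichlet_heat_kernel_mono[OF assms(1) order.refl assms(3)] assms(2) fin
    by (intro sum_mono2) auto
  also have "\<dots> = (\<Sum>y\<in>?W. dirichlet_heat_kernel E U t x y * 1)"
    using assms(2) fin by (intro sum.mono_neutral_cong_right) (auto simp: dirichlet_heat_kernel_def)
  also have "\<dots> = heat_flow E ?W t (zero_ext ?W (\<lambda>_. 1)) x"
    using sum_dirichlet_heat_kernel[OF assms(1), of E t x "\<lambda>_. 1"] by simp
  also have "\<dots> \<le> 1"
  proof -
    have "\<bar>heat_flow E ?W t (zero_ext ?W (\<lambda>_. 1)) x\<bar> \<le> 1"
      by (rule abs_heat_flow_le[OF deg c _ _ assms(3)]) (auto simp: zero_ext_def)
    then show ?thesis by simp
  qed
  finally show ?thesis .
qed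

section \<open>The limit along an exhaustion\<close>

text \<open>A quadratic remainder identifies the derivative. Only times \<open>s \<ge> 0\<close> are used, since the heat
  flow is controlled only there.\<close>

lemma has_real_derivative_of_quadratic_bound:
  fixes g :: "real \<Rightarrow> real"
  assumes "0 < t" and "\<And>s. 0 \<le> s \<Longrightarrow> \<bar>g s - g t - (s - t) * D\<bar> \<le> K * (s - t)\<^sup>2"
  shows "(g has_real_derivative D) (at t)"
proof -
  have "eventually (\<lambda>s. 0 < s) (at t)"
    using order_tendstoD(1)[OF tendsto_ident_at \<open>0 < t\<close>] .
  moreover have "eventually (\<lambda>s. s \<noteq> t) (at t)"
    by (simp add: eventually_at_filter)
  ultimately have "eventually (\<lambda>s. norm ((g s - g t) / (s - t) - D) \<le> K * \<bar>s - t\<bar>) (at t)"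
  proof eventually_elim
    case (elim s)
    then have "(g s - g t) / (s - t) - D = (g s - g t - (s - t) * D) / (s - t)"
      by (simp add: field_simps)
    then have "norm ((g s - g t) / (s - t) - D) = \<bar>g s - g t - (s - t) * D\<bar> / \<bar>s - t\<bar>"
      by simp
    also have "\<dots> \<le> K * (s - t)\<^sup>2 / \<bar>s - t\<bar>"
      using assms(2)[of s] elim by (intro divide_right_mono) auto
    also have "\<dots> = K * \<bar>s - t\<bar>"
      using elim by (auto simp: power2_eq_square abs_if field_simps)
    finally show ?case .
  qed
  moreover have "((\<lambda>s. K * \<bar>s - t\<bar>) \<longlongrightarrow> 0) (at t)"
    by (auto intro!: tendsto_eq_intros)
  ultimately have "((\<lambda>s. (g s - g t) / (s - t) - D) \<longlongrightarrow> 0) (at t)"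
    by (rule Lim_null_comparison)
  then show ?thesis
    by (simp add: has_field_derivative_iff Lim_null[symmetric])
qed

definition limit_kernel ::
    "'a set set \<Rightarrow> (nat \<Rightarrow> 'a set) \<Rightarrow> real \<Rightarrow> 'a \<Rightarrow> 'a \<Rightarrow> real" where
  "limit_kernel E U t x y = lim (\<lambda>k. dirichlet_heat_kernel E (U k) t x y)"

context
  fixes V :: "'a set" and E :: "'a set set" and U :: "nat \<Rightarrow> 'a set"
  assumes exh: "exhaustion V E U"
begin

lemma exhaustion_finite: "finite (U k)"
  using exh by (simp add: exhaustion_def)

lemma exhaustion_subset: "U k \<subseteq> V"
  using exh by (simp add: exhaustion_def)

lemma incseq_exhaustion: "incseq U"
  using exh by (intro incseq_SucI) (auto simp: exhaustion_def graph_interior_def)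

lemma eventually_mem_interior:
  assumes "x \<in> V"
  shows "eventually (\<lambda>k. x \<in> graph_interior E (U k)) sequentially"
proof -
  obtain k where "x \<in> U k" using exh assms by (auto simp: exhaustion_def)
  then have "x \<in> graph_interior E (U (Suc k))" using exh by (auto simp: exhaustion_def)
  then show ?thesis
    using graph_interior_mono[OF incseqD[OF incseq_exhaustion]]
    by (auto simp: eventually_sequentially intro!: exI[of _ "Suc k"])
qed

context
  fixes t :: real
  assumes t: "0 \<le> t"
begin

lemma incseq_dirichlet_heat_kernel: "incseq (\<lambda>k. dirichlet_heat_kernel E (U k) t x y)"
  using dirichlet_heat_kernel_mono[OF exhaustion_finite incseq_SucD[OF incseq_exhaustion] t]
  by (intro incseq_SucI) auto

lemma LIMSEQ_limit_kernel:
  "(\<lambda>k. dirichlet_heat_kernel E (U k) t x y) \<longlonglongrightarrow> limit_kernel E U t x y"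
proof -
  have "dirichlet_heat_kernel E (U k) t x y \<le> 1" for k
    using sum_dirichlet_heat_kernel_le_1[OF exhaustion_finite _ t, of "{y}"] by simp
  then have "convergent (\<lambda>k. dirichlet_heat_kernel E (U k) t x y)"
    by (metis incseq_convergent[OF incseq_dirichlet_heat_kernel] convergentI)
  then show ?thesis
    unfolding limit_kernel_def by (simp add: convergent_LIMSEQ_iff)
qed

lemma dirichlet_heat_kernel_le_limit_kernel:
  "dirichlet_heat_kernel E (U k) t x y \<le> limit_kernel E U t x y"
  using incseq_le[OF incseq_dirichlet_heat_kernel LIMSEQ_limit_kernel] .

lemma dirichlet_heat_kernel_nonneg: "0 \<le> dirichlet_heat_kernel E (U k) t x y"
  using dirichlet_heat_kernel_mono[OF exhaustion_finite order.refl t] by blast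

lemma exhaustion_heat_kernel_eq: "exhaustion_heat_kernel E U t x y = ereal (limit_kernel E U t x y)"
  unfolding exhaustion_heat_kernel_def
  by (intro limI tendsto_ereal LIMSEQ_limit_kernel)

lemma summable_limit_kernel: "limit_kernel E U t x summable_on V"
proof (rule nonneg_bdd_above_summable_on)
  show "0 \<le> limit_kernel E U t x y" for y
    using dirichlet_heat_kernel_nonneg dirichlet_heat_kernel_le_limit_kernel by (rule order.trans)
  have "sum (limit_kernel E U t x) F \<le> 1" if "finite F" for F
    by (rule LIMSEQ_le_const2[OF tendsto_sum[OF LIMSEQ_limit_kernel]])
      (use sum_dirichlet_heat_kernel_le_1[OF exhaustion_finite that t] in auto)
  then show "bdd_above (sum (limit_kernel E U t x) ` {F. F \<subseteq> V \<and> finite F})"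
    by (auto intro!: bdd_aboveI2)
qed

context
  fixes u0 :: "'a \<Rightarrow> real" and C :: real
  assumes u0: "\<And>y. y \<in> V \<Longrightarrow> \<bar>u0 y\<bar> \<le> C"
begin

lemma summable_limit_kernel_mult: "(\<lambda>y. limit_kernel E U t x y * u0 y) summable_on V"
proof -
  have "(\<lambda>y. norm (limit_kernel E U t x y * u0 y)) summable_on V"
  proof (rule Infinite_Sum.abs_summable_on_comparison_test'[OF
        summable_on_cmult_left[OF summable_limit_kernel, where c = C]])
    fix y assume y: "y \<in> V"
    have "0 \<le> limit_kernel E U t x y"
      using dirichlet_heat_kernel_nonneg dirichlet_heat_kernel_le_limit_kernel by (rule order.trans)
    then show "norm (limit_kernel E U t x y * u0 y) \<le> limit_kernel E U t x y * C"
      using u0[OF y] by (simp add: abs_mult mult_left_mono)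
  qed
  then show ?thesis by (rule abs_summable_summable)
qed

text \<open>The increasing kernels are dominated by their summable limit.\<close>

lemma LIMSEQ_heat_flow:
  "(\<lambda>k. heat_flow E (graph_interior E (U k)) t (zero_ext (graph_interior E (U k)) u0) x)
    \<longlonglongrightarrow> (\<Sum>\<^sub>\<infinity>y\<in>V. limit_kernel E U t x y * u0 y)"
proof -
  have "heat_flow E (graph_interior E (U k)) t (zero_ext (graph_interior E (U k)) u0) x =
      (\<Sum>\<^sub>\<infinity>y\<in>V. dirichlet_heat_kernel E (U k) t x y * u0 y)" for k
  proof -
    let ?W = "graph_interior E (U k)"
    have "?W \<subseteq> V" using exhaustion_subset by (auto simp: graph_interior_def)
    then have "(\<Sum>\<^sub>\<infinity>y\<in>V. dirichlet_heat_kernel E (U k) t x y * u0 y) =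
        (\<Sum>\<^sub>\<infinity>y\<in>?W. dirichlet_heat_kernel E (U k) t x y * u0 y)"
      by (intro infsum_cong_neutral) (auto simp: dirichlet_heat_kernel_def)
    then show ?thesis
      using finite_graph_interior[OF exhaustion_finite]
      by (simp add: sum_dirichlet_heat_kernel[OF exhaustion_finite, symmetric])
  qed
  moreover have "(\<lambda>k. \<Sum>\<^sub>\<infinity>y\<in>V. dirichlet_heat_kernel E (U k) t x y * u0 y)
      \<longlonglongrightarrow> (\<Sum>\<^sub>\<infinity>y\<in>V. limit_kernel E U t x y * u0 y)"
  proof (rule infsum_dominated_convergence[OF
        summable_on_cmult_left[OF summable_limit_kernel, where c = C]])
    fix k y assume y: "y \<in> V"
    show "\<bar>dirichlet_heat_kernel E (U k) t x y * u0 y\<bar> \<le> limit_kernel E U t x y * C"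
      unfolding abs_mult
      using u0[OF y] dirichlet_heat_kernel_nonneg[of k x y]
        dirichlet_heat_kernel_le_limit_kernel[of k x y]
      by (intro mult_mono) auto
    show "(\<lambda>k. dirichlet_heat_kernel E (U k) t x y * u0 y)
        \<longlonglongrightarrow> limit_kernel E U t x y * u0 y"
      by (intro tendsto_mult LIMSEQ_limit_kernel tendsto_const)
  qed
  ultimately show ?thesis by simp
qed

end

end

context
  fixes u0 :: "'a \<Rightarrow> real" and C :: real and x :: 'a
  assumes u0: "\<And>y. y \<in> V \<Longrightarrow> \<bar>u0 y\<bar> \<le> C" and x: "x \<in> V"
begin

lemma abs_zero_ext_interior_le: "\<bar>zero_ext (graph_interior E (U k)) u0 y\<bar> \<le> C"
proof -
  have "0 \<le> C" using u0[OF x] by simp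
  then show ?thesis
    using u0 exhaustion_subset[of k] by (auto simp: zero_ext_def graph_interior_def)
qed

text \<open>The Lipschitz estimate between times \<open>0\<close> and \<open>t\<close>, carried to the limit. At time \<open>0\<close> the
  approximations already equal \<open>u0 x\<close> once \<open>x\<close> is interior.\<close>

lemma limit_solution_initial:
  assumes "0 \<le> t"
  shows "\<bar>(\<Sum>\<^sub>\<infinity>y\<in>V. limit_kernel E U t x y * u0 y) - u0 x\<bar> \<le> 2 * vertex_degree E x * C * t"
proof (rule tendsto_upperbound)
  show "(\<lambda>k. \<bar>heat_flow E (graph_interior E (U k)) t (zero_ext (graph_interior E (U k)) u0) x - u0 x\<bar>)
      \<longlonglongrightarrow> \<bar>(\<Sum>\<^sub>\<infinity>y\<in>V. limit_kernel E U t x y * u0 y) - u0 x\<bar>"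
    by (intro tendsto_rabs tendsto_diff LIMSEQ_heat_flow[OF assms u0] tendsto_const)
  show "eventually (\<lambda>k. \<bar>heat_flow E (graph_interior E (U k)) t
      (zero_ext (graph_interior E (U k)) u0) x - u0 x\<bar> \<le> 2 * vertex_degree E x * C * t) sequentially"
    using eventually_mem_interior[OF x]
  proof eventually_elim
    case (elim k)
    let ?W = "graph_interior E (U k)"
    obtain c where c: "0 \<le> c" and deg: "\<And>x. x \<in> ?W \<Longrightarrow> vertex_degree E x \<le> c"
      using vertex_degree_bounded_on_finite[OF finite_graph_interior[OF exhaustion_finite]] by metis
    have "\<bar>heat_flow E ?W t (zero_ext ?W u0) x - heat_flow E ?W 0 (zero_ext ?W u0) x\<bar>
        \<le> 2 * vertex_degree E x * C * \<bar>t - 0\<bar>"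
      by (rule abs_heat_flow_diff_le[OF deg c zero_ext_zero_ext abs_zero_ext_interior_le assms order.refl])
    then show ?case
      using assms elim by (simp add: heat_flow_0 zero_ext_def)
  qed
qed simp

text \<open>The Taylor estimate is carried to the limit; the Laplacian of the approximations converges
  because it only involves the values at \<open>x\<close> and its neighbours.\<close>

lemma limit_solution_has_derivative:
  assumes t: "0 < t"
  shows "((\<lambda>t. \<Sum>\<^sub>\<infinity>y\<in>V. limit_kernel E U t x y * u0 y) has_real_derivative
    - laplacian E (\<lambda>z. \<Sum>\<^sub>\<infinity>y\<in>V. limit_kernel E U t z y * u0 y) x) (at t)"
proof (rule has_real_derivative_of_quadratic_bound[OF t])
  fix s :: real assume s: "0 \<le> s"
  have t0: "0 \<le> t" using t by simp
  let ?W = "\<lambda>k. graph_interior E (U k)"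
  let ?v = "\<lambda>k t. heat_flow E (?W k) t (zero_ext (?W k) u0)"
  let ?u = "\<lambda>t x. \<Sum>\<^sub>\<infinity>y\<in>V. limit_kernel E U t x y * u0 y"
  let ?K = "\<Sum>y | adj E y x. 2 * (vertex_degree E x + vertex_degree E y) * C"
  show "\<bar>?u s x - ?u t x - (s - t) * (- laplacian E (?u t) x)\<bar> \<le> ?K * (s - t)\<^sup>2"
  proof (rule tendsto_upperbound)
    show "(\<lambda>k. \<bar>?v k s x - ?v k t x - (s - t) * (- laplacian E (?v k t) x)\<bar>)
        \<longlonglongrightarrow> \<bar>?u s x - ?u t x - (s - t) * (- laplacian E (?u t) x)\<bar>"
      unfolding laplacian_def
      by (intro tendsto_intros LIMSEQ_heat_flow[OF _ u0] s t0)
    show "eventually (\<lambda>k. \<bar>?v k s x - ?v k t x - (s - t) * (- laplacian E (?v k t) x)\<bar>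
        \<le> ?K * (s - t)\<^sup>2) sequentially"
      using eventually_mem_interior[OF x]
    proof eventually_elim
      case (elim k)
      obtain c where c: "0 \<le> c" and deg: "\<And>x. x \<in> ?W k \<Longrightarrow> vertex_degree E x \<le> c"
        using vertex_degree_bounded_on_finite[OF finite_graph_interior[OF exhaustion_finite]] by metis
      show ?case
        by (rule heat_flow_taylor[OF deg c zero_ext_zero_ext abs_zero_ext_interior_le elim s t0])
    qed
  qed simp
qed

end

lemma fundamental_solution_limit_kernel:
  assumes p: "\<And>t x y. 0 < t \<Longrightarrow> p t x y = limit_kernel E U t x y"
  shows "fundamental_solution V E p"
  unfolding fundamental_solution_def Let_def
proof (intro allI impI)
  fix u0 :: "'a \<Rightarrow> real"
  assume "bounded (u0 ` V)"
  then obtain C where C: "\<And>y. y \<in> V \<Longrightarrow> \<bar>u0 y\<bar> \<le> C"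
    by (auto simp: bounded_iff)
  let ?u = "\<lambda>t x. \<Sum>\<^sub>\<infinity>y\<in>V. p t x y * u0 y"
  let ?w = "\<lambda>t x. \<Sum>\<^sub>\<infinity>y\<in>V. limit_kernel E U t x y * u0 y"
  have uw: "?u t = ?w t" if "0 < t" for t
    using p[OF that] by simp
  have deriv: "((\<lambda>t. ?u t x) has_real_derivative - laplacian E (?u t) x) (at t)"
    if "0 < t" "x \<in> V" for t x
  proof -
    have "eventually (\<lambda>s. 0 < s) (nhds t)"
      using order_tendstoD(1)[OF filterlim_ident \<open>0 < t\<close>] by simp
    then have "eventually (\<lambda>s. ?u s x = ?w s x) (nhds t)"
      by eventually_elim (use uw in metis)
    moreover have "- laplacian E (?u t) x = - laplacian E (?w t) x"
      using uw[OF that(1)] by simp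
    ultimately show ?thesis
      using limit_solution_has_derivative[OF C that(2,1)] by (subst DERIV_cong_ev[OF refl])
  qed
  have differentiable: "(\<lambda>t. ?u t x) differentiable (at t)" if "0 < t" "x \<in> V" for t x
    using deriv[OF that] real_differentiable_def by blast
  have summable: "(\<lambda>y. p t x y * u0 y) summable_on V" if "0 < t" for t x
    using summable_limit_kernel_mult[OF _ C, where t = t and x = x] that p[OF that] by simp
  have "((\<lambda>t. ?u t x) \<longlongrightarrow> u0 x) (at_right 0)" if "x \<in> V" for x
  proof -
    have "eventually (\<lambda>t. norm (?u t x - u0 x) \<le> 2 * vertex_degree E x * C * t) (at_right 0)"
      using eventually_at_right_less[of "0::real"]
    proof eventually_elim
      case (elim t)
      then show ?case
        using limit_solution_initial[OF C that, where t = t] fun_cong[OF uw[OF elim], of x] by simp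
    qed
    moreover have "((\<lambda>t. 2 * vertex_degree E x * C * t) \<longlongrightarrow> 0) (at_right 0)"
      by (auto intro!: tendsto_eq_intros)
    ultimately have "((\<lambda>t. ?u t x - u0 x) \<longlongrightarrow> 0) (at_right 0)"
      by (rule Lim_null_comparison)
    then show ?thesis by (simp add: Lim_null[symmetric])
  qed
  then show "(\<forall>t>0. \<forall>x\<in>V. (\<lambda>y. p t x y * u0 y) summable_on V) \<and>
      (\<forall>t>0. \<forall>x\<in>V. (\<lambda>s. ?u s x) differentiable (at t)) \<and>
      (\<forall>t>0. \<forall>x\<in>V. deriv (\<lambda>s. ?u s x) t + laplacian E (?u t) x = 0) \<and>
      (\<forall>x\<in>V. ((\<lambda>t. ?u t x) \<longlongrightarrow> u0 x) (at_right 0))"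
    using summable differentiable DERIV_imp_deriv[OF deriv] by auto
qed

end

text \<open>Every member of one exhaustion lies in a member of the other, so the kernels interleave.\<close>

lemma limit_kernel_le:
  assumes exh: "exhaustion V E U" and exh': "exhaustion V E U'" and t: "0 \<le> t"
  shows "limit_kernel E U t x y \<le> limit_kernel E U' t x y"
proof (rule LIMSEQ_le_const2[OF LIMSEQ_limit_kernel[OF exh t]])
  have "dirichlet_heat_kernel E (U k) t x y \<le> limit_kernel E U' t x y" for k
  proof -
    have directed: "\<exists>j. F \<subseteq> U' j" if "finite F" "F \<subseteq> (\<Union>j. U' j)" for F
      using that
    proof (induction F)
      case empty
      show ?case by simp
    next
      case (insert z F)
      then obtain i j where "F \<subseteq> U' i" "z \<in> U' j" by auto
      then have "insert z F \<subseteq> U' (max i j)"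
        using incseqD[OF incseq_exhaustion[OF exh'], of i "max i j"]
          incseqD[OF incseq_exhaustion[OF exh'], of j "max i j"] by auto
      then show ?case by blast
    qed
    obtain j where j: "U k \<subseteq> U' j"
      using directed[OF exhaustion_finite[OF exh, of k]] exhaustion_subset[OF exh, of k]
        exh' by (auto simp: exhaustion_def)
    have "dirichlet_heat_kernel E (U k) t x y \<le> dirichlet_heat_kernel E (U' j) t x y"
      using dirichlet_heat_kernel_mono[OF exhaustion_finite[OF exh'] j t] by blast
    also have "\<dots> \<le> limit_kernel E U' t x y"
      by (rule dirichlet_heat_kernel_le_limit_kernel[OF exh' t])
    finally show ?thesis .
  qed
  then show "\<exists>N. \<forall>k\<ge>N. dirichlet_heat_kernel E (U k) t x y \<le> limit_kernel E U' t x y"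
    by blast
qed

theorem theorem4p10:
  fixes V :: "'a set" and E :: "'a set set" and U :: "nat \<Rightarrow> 'a set"
  assumes "locally_finite_graph V E"
    and "exhaustion V E U"
  shows "(\<forall>t>0. \<forall>x\<in>V. \<forall>y\<in>V.
            (\<lambda>k. ereal (dirichlet_heat_kernel E (U k) t x y))
              \<longlonglongrightarrow> exhaustion_heat_kernel E U t x y \<and>
            0 \<le> exhaustion_heat_kernel E U t x y \<and> exhaustion_heat_kernel E U t x y < \<infinity>)
       \<and> fundamental_solution V E (\<lambda>t x y. real_of_ereal (exhaustion_heat_kernel E U t x y))
       \<and> (\<forall>U'. exhaustion V E U' \<longrightarrow>
            (\<forall>t>0. \<forall>x\<in>V. \<forall>y\<in>V.
              exhaustion_heat_kernel E U' t x y = exhaustion_heat_kernel E U t x y))"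
proof (intro conjI allI impI ballI)
  fix t :: real and x y
  assume t: "0 < t"
  then have t0: "0 \<le> t" by simp
  note eq = exhaustion_heat_kernel_eq[OF assms(2) t0]
  show "(\<lambda>k. ereal (dirichlet_heat_kernel E (U k) t x y)) \<longlonglongrightarrow> exhaustion_heat_kernel E U t x y"
    unfolding eq by (intro tendsto_ereal LIMSEQ_limit_kernel[OF assms(2) t0])
  show "0 \<le> exhaustion_heat_kernel E U t x y"
    using order.trans[OF dirichlet_heat_kernel_nonneg[OF assms(2) t0]
        dirichlet_heat_kernel_le_limit_kernel[OF assms(2) t0]]
    by (simp add: eq)
  show "exhaustion_heat_kernel E U t x y < \<infinity>"
    by (simp add: eq)
  show "exhaustion_heat_kernel E U' t x y = exhaustion_heat_kernel E U t x y"
    if "exhaustion V E U'" for U'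
    unfolding eq exhaustion_heat_kernel_eq[OF that t0]
    using limit_kernel_le[OF that assms(2) t0] limit_kernel_le[OF assms(2) that t0]
    by (simp add: order.antisym)
next
  show "fundamental_solution V E (\<lambda>t x y. real_of_ereal (exhaustion_heat_kernel E U t x y))"
    by (rule fundamental_solution_limit_kernel[OF assms(2)])
      (simp add: exhaustion_heat_kernel_eq[OF assms(2)])
qed

end
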